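(* For all integers $d\ge 2$, we have $\mathrm{dmg}(Q_d)=2^{d-2}$.
   Context: $Q_d$ is the $d$-dimensional hypercube graph: its vertices are the $0,1$-sequences of length $d$, and two are adjacent iff they differ in exactly one coordinate. Damage number. One cop and one robber play on a graph $G$ with perfect information. First the cop chooses a starting vertex, then the robber chooses a starting vertex (this placement is round $0$). Each subsequent round consists of a move of the cop followed by a move of the robber; in a move a player either stays at the current vertex or moves to a neighboring vertex. If the cop ever occupies the same vertex as the robber, the robber is captured and the game ends. If a vertex $v$ is occupied by the robber at the end of a round and the robber is not caught in the following round, then $v$ becomes damaged and stays damaged for the rest of the game. The cop wants to minimize, and the robber to maximize, the number of damaged vertices. The damage number $\mathrm{dmg}(G)$ is the number of damaged vertices when both play optimally, i.e. the maximum number of vertices the robber can guarantee to damage no matter the strategy of the cop. *)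

theory Defs
  imports "Graph_Theory.Pair_Digraph"
begin

text \<open>The hypercube graph. A 0,1-sequence of length \<open>d\<close> is a boolean list of length \<open>d\<close>; an
  undirected graph is a symmetric, loop-free digraph (locale \<open>pair_graph\<close>), so every edge is
  present in both directions.\<close>

definition hypercube :: "nat \<Rightarrow> bool list pair_pre_digraph" where
  "hypercube d = \<lparr> pverts = {x. length x = d},
     parcs = {(x, y). length x = d \<and> length y = d \<and> (\<exists>!i. i < d \<and> x ! i \<noteq> y ! i)} \<rparr>"

lemma pair_graph_hypercube: "pair_graph (hypercube d)"
proof -
  have arcD: "length (fst e) = d \<and> length (snd e) = d \<and> fst e \<noteq> snd e"
    if "e \<in> parcs (hypercube d)" for e
  proof -
    have "length (fst e) = d \<and> length (snd e) = d \<and> (\<exists>i. fst e ! i \<noteq> snd e ! i)"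
      using that unfolding hypercube_def by (cases e) (simp, blast)
    then show ?thesis by metis
  qed
  have sym: "sym (parcs (hypercube d))"
  proof (rule symI)
    fix x y :: "bool list"
    have "(x ! i \<noteq> y ! i) = (y ! i \<noteq> x ! i)" for i
      by (rule neq_commute)
    then show "(y, x) \<in> parcs (hypercube d)" if "(x, y) \<in> parcs (hypercube d)"
      using that by (simp only: hypercube_def pair_pre_digraph.simps mem_Collect_eq prod.case)
  qed
  have verts: "pverts (hypercube d) = {x. length x = d}"
    by (simp add: hypercube_def)
  have fin: "finite (pverts (hypercube d))"
    using finite_lists_length_eq[of "UNIV :: bool set" d] by (simp add: verts)
  have sub: "parcs (hypercube d) \<subseteq> pverts (hypercube d) \<times> pverts (hypercube d)"
    using arcD by (simp add: verts subset_iff mem_Times_iff)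
  show ?thesis
  proof
    show "symmetric (with_proj (hypercube d))"
      using sym by (simp add: symmetric_def)
    show "finite (parcs (hypercube d))"
      using finite_subset[OF sub] fin by simp
  qed (use arcD fin in \<open>simp_all add: verts\<close>)
qed

text \<open>A history is the list of the positions (cop, robber) at the ends of the rounds played so
  far, starting with round 0. The cop answers a history with her next position. The robber
  answers a history together with the new position of the cop. On the empty history the answers
  are the starting vertices.\<close>

type_synonym 'a history = "('a \<times> 'a) list"
type_synonym 'a cop_strategy = "'a history \<Rightarrow> 'a"
type_synonym 'a robber_strategy = "'a history \<Rightarrow> 'a \<Rightarrow> 'a"

definition legal_move :: "'a pair_pre_digraph \<Rightarrow> 'a \<Rightarrow> 'a \<Rightarrow> bool" where
  "legal_move G u v \<longleftrightarrow> v = u \<or> (u, v) \<in> parcs G"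

definition cop_strategy :: "'a pair_pre_digraph \<Rightarrow> 'a cop_strategy \<Rightarrow> bool" where
  "cop_strategy G \<sigma> \<longleftrightarrow>
     (\<forall>h. set h \<subseteq> pverts G \<times> pverts G \<longrightarrow>
        \<sigma> h \<in> pverts G \<and> (h \<noteq> [] \<longrightarrow> legal_move G (fst (last h)) (\<sigma> h)))"

definition robber_strategy :: "'a pair_pre_digraph \<Rightarrow> 'a robber_strategy \<Rightarrow> bool" where
  "robber_strategy G \<rho> \<longleftrightarrow>
     (\<forall>h c. set h \<subseteq> pverts G \<times> pverts G \<longrightarrow> c \<in> pverts G \<longrightarrow>
        \<rho> h c \<in> pverts G \<and> (h \<noteq> [] \<longrightarrow> legal_move G (snd (last h)) (\<rho> h c)))"

text \<open>The positions at the ends of the first \<open>n\<close> rounds, that is, of the rounds before round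
  \<open>n\<close>. Plays are continued formally after a capture; what happens then is disregarded in
  \<open>damaged\<close> below.\<close>

primrec history :: "'a cop_strategy \<Rightarrow> 'a robber_strategy \<Rightarrow> nat \<Rightarrow> 'a history" where
  "history \<sigma> \<rho> 0 = []"
| "history \<sigma> \<rho> (Suc n) =
     (let h = history \<sigma> \<rho> n; c = \<sigma> h in h @ [(c, \<rho> h c)])"

definition cop_at :: "'a cop_strategy \<Rightarrow> 'a robber_strategy \<Rightarrow> nat \<Rightarrow> 'a" where
  "cop_at \<sigma> \<rho> n = \<sigma> (history \<sigma> \<rho> n)"

definition robber_at :: "'a cop_strategy \<Rightarrow> 'a robber_strategy \<Rightarrow> nat \<Rightarrow> 'a" where
  "robber_at \<sigma> \<rho> n = \<rho> (history \<sigma> \<rho> n) (cop_at \<sigma> \<rho> n)"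

text \<open>The robber is caught in round \<open>m\<close> either by the move of the cop, who enters the vertex
  where the robber ended the preceding round, or by his own placement or move onto the vertex
  of the cop.\<close>

definition caught_in :: "'a cop_strategy \<Rightarrow> 'a robber_strategy \<Rightarrow> nat \<Rightarrow> bool" where
  "caught_in \<sigma> \<rho> m \<longleftrightarrow>
     (m > 0 \<and> cop_at \<sigma> \<rho> m = robber_at \<sigma> \<rho> (m - 1)) \<or> cop_at \<sigma> \<rho> m = robber_at \<sigma> \<rho> m"

definition damaged :: "'a cop_strategy \<Rightarrow> 'a robber_strategy \<Rightarrow> 'a set" where
  "damaged \<sigma> \<rho> = {robber_at \<sigma> \<rho> n | n. \<forall>m \<le> Suc n. \<not> caught_in \<sigma> \<rho> m}"

text \<open>The set below contains 0 and is bounded by the number of vertices if \<open>G\<close> is finite and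
  has a vertex, so that its maximum is meaningful.\<close>

definition dmg :: "'a pair_pre_digraph \<Rightarrow> nat" where
  "dmg G = Max {k. \<exists>\<rho>. robber_strategy G \<rho> \<and>
                     (\<forall>\<sigma>. cop_strategy G \<sigma> \<longrightarrow> k \<le> card (damaged \<sigma> \<rho>))}"

end

theory Submission
  imports Defs
begin

text \<open>Everything is expressed through the set \<open>S\<close> of coordinates in which the cop differs from
  the robber. A player who moves toggles one element of \<open>S\<close>, and a capture means \<open>S = {}\<close>.

  \<^bold>\<open>Upper bound.\<close> The cop makes \<open>S\<close> even in her first move and keeps it even after each of her
  moves. If the robber leaves along a coordinate outside \<open>S\<close>, she copies him. If he moves along
  a coordinate of \<open>S\<close>, then \<open>S\<close> becomes odd and she moves along any remaining element, so that
  \<open>S\<close> loses two elements. Hence the robber has never moved along a coordinate that is in \<open>S\<close> at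
  present: all vertices that he has visited agree on \<open>S\<close>. As long as he is free, \<open>S\<close> is even and
  nonempty, so two coordinates are fixed and the visited vertices lie in a subcube with
  \<open>2 ^ (d - 2)\<close> vertices (\<open>confining_invariant\<close>, \<open>damaged_confining\<close>).

  \<^bold>\<open>Lower bound.\<close> By induction on the dimension of a subcube \<open>D\<close>, a robber who moves
  only along \<open>D\<close>, and against whom the cop's projection to \<open>D\<close> is currently at positive distance,
  can damage a quarter of \<open>D\<close> and end at positive projected distance again
  (\<open>robber_forces_quarter\<close>). Split \<open>D\<close> along some \<open>k\<close> into two halves with directions \<open>F\<close>.
  The induction hypothesis yields a quarter of the first half. Then the robber wants to
  cross to the other half and repeat. Two situations stand in the way.

  \<^item> Before crossing, \<open>S\<close> can be \<open>{k, m}\<close> within \<open>D\<close>: crossing would let the cop's projection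
    capture him. The robber then moves on in his half, along any direction other than \<open>m\<close>;
    after his move along \<open>l\<close> the cop can only preserve the obstruction by making the difference
    \<open>{k, m}\<close> or \<open>{k, l}\<close>. While she does so, half of his half, that is a quarter of \<open>D\<close>, can be visited
    (\<open>robber_forces_chase\<close>); when she does not, he crosses.
  \<^item> After crossing, \<open>S\<close> can be \<open>{k}\<close> within \<open>D\<close>. Then all moves within the new half are safe, and
    the robber walks through all of it until the cop lets the projected distance become
    positive (\<open>robber_forces_tour\<close>).

  The inductive predicate \<open>robber_forces\<close> makes such concatenations of plans easy; as the cop has
  finitely many replies, a forced goal is forced within a bounded number of rounds, and
  decreasing the bound turns the plan into a strategy (\<open>forcing_strategy_reaches\<close>).\<close>

section \<open>Vertices and their differences\<close>

definition flip :: "nat \<Rightarrow> bool list \<Rightarrow> bool list" where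
  "flip k x = x[k := \<not> x ! k]"

definition toggle :: "'a \<Rightarrow> 'a set \<Rightarrow> 'a set" where
  "toggle k S = (if k \<in> S then S - {k} else insert k S)"

definition diff :: "bool list \<Rightarrow> bool list \<Rightarrow> nat set" where
  "diff x y = {i. i < length x \<and> x ! i \<noteq> y ! i}"

definition subcube :: "bool list \<Rightarrow> nat set \<Rightarrow> bool list set" where
  "subcube x D = {y. length y = length x \<and> (\<forall>i < length x. i \<notin> D \<longrightarrow> y ! i = x ! i)}"

lemma mem_toggle: "y \<in> toggle x S \<longleftrightarrow> (y \<in> S) \<noteq> (y = x)"
  by (auto simp: toggle_def)

lemma length_flip [simp]: "length (flip k x) = length x"
  by (simp add: flip_def)

lemma nth_flip: "i < length x \<Longrightarrow> flip k x ! i = (if i = k then \<not> x ! i else x ! i)"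
  by (simp add: flip_def nth_list_update)

lemma diff_flip_left: "k < length x \<Longrightarrow> diff (flip k x) y = toggle k (diff x y)"
  by (auto simp: diff_def toggle_def nth_flip split: if_splits)

lemma diff_flip_right:
  "k < length x \<Longrightarrow> length y = length x \<Longrightarrow> diff x (flip k y) = toggle k (diff x y)"
  by (auto simp: diff_def toggle_def nth_flip split: if_splits)

lemma diff_empty_iff: "length x = length y \<Longrightarrow> diff x y = {} \<longleftrightarrow> x = y"
  by (auto simp: diff_def list_eq_iff_nth_eq)

lemma finite_diff [simp]: "finite (diff x y)"
  by (simp add: diff_def)

lemma pverts_hypercube: "pverts (hypercube d) = {x. length x = d}"
  by (simp add: hypercube_def)

lemma legal_move_hypercube:
  assumes "length x = d"
  shows "legal_move (hypercube d) x y \<longleftrightarrow> y = x \<or> (\<exists>k<d. y = flip k x)"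
proof -
  have "(\<exists>!i. i < d \<and> x ! i \<noteq> y ! i) \<longleftrightarrow> (\<exists>k<d. y = flip k x)" if "length y = d"
  proof
    assume "\<exists>!i. i < d \<and> x ! i \<noteq> y ! i"
    then obtain k where k: "k < d" "x ! k \<noteq> y ! k" "\<And>i. i < d \<Longrightarrow> x ! i \<noteq> y ! i \<Longrightarrow> i = k"
      by blast
    have "y ! i = flip k x ! i" if "i < d" for i
    proof (cases "i = k")
      case True
      then show ?thesis using k(1,2) assms by (simp add: nth_flip)
    next
      case False
      then have "x ! i = y ! i" using k(3) that by blast
      then show ?thesis using False that assms by (simp add: nth_flip)
    qed
    then show "\<exists>k<d. y = flip k x"
      using k(1) assms that list_eq_iff_nth_eq[of y "flip k x"] by auto
  next
    assume "\<exists>k<d. y = flip k x"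
    then obtain k where "k < d" "y = flip k x" by blast
    then show "\<exists>!i. i < d \<and> x ! i \<noteq> y ! i"
      using assms by (intro ex1I[of _ k]) (auto simp: nth_flip split: if_splits)
  qed
  then show ?thesis
    using assms by (auto simp: legal_move_def hypercube_def)
qed

lemma subcube_self [simp]: "x \<in> subcube x D"
  by (simp add: subcube_def)

lemma subcube_empty [simp]: "subcube x {} = {x}"
  by (auto simp: subcube_def list_eq_iff_nth_eq)

lemma length_subcube: "y \<in> subcube x D \<Longrightarrow> length y = length x"
  by (simp add: subcube_def)

lemma subcube_eq: "y \<in> subcube x D \<Longrightarrow> subcube y D = subcube x D"
  by (auto simp: subcube_def)

lemma subcube_mono: "C \<subseteq> D \<Longrightarrow> subcube x C \<subseteq> subcube x D"
  by (auto simp: subcube_def)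

lemma finite_subcube [simp]: "finite (subcube x D)"
proof (rule finite_subset)
  show "subcube x D \<subseteq> {y. length y = length x}" by (auto simp: subcube_def)
  show "finite {y::bool list. length y = length x}"
    using finite_lists_length_eq[of "UNIV :: bool set" "length x"] by simp
qed

text \<open>Any vertex \<open>y\<close> of the first half can serve as the place to cross to the second one; the
  robber does not choose where a plan for the first half ends.\<close>

lemma subcube_insert:
  assumes "y \<in> subcube x D" "k < length x" "k \<notin> D"
  shows "subcube x (insert k D) = subcube x D \<union> subcube (flip k y) D"
    and "subcube x D \<inter> subcube (flip k y) D = {}"
proof -
  show "subcube x D \<inter> subcube (flip k y) D = {}"
    using assms by (force simp: subcube_def nth_flip)
  show "subcube x (insert k D) = subcube x D \<union> subcube (flip k y) D"
  proof (intro equalityI subsetI)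
    fix z assume z: "z \<in> subcube x (insert k D)"
    show "z \<in> subcube x D \<union> subcube (flip k y) D"
    proof (cases "z ! k = x ! k")
      case True
      then have "z \<in> subcube x D" using z by (auto simp: subcube_def)
      then show ?thesis ..
    next
      case False
      then have "z \<in> subcube (flip k y) D"
        using z assms by (auto simp: subcube_def nth_flip)
      then show ?thesis ..
    qed
  next
    fix z assume "z \<in> subcube x D \<union> subcube (flip k y) D"
    then show "z \<in> subcube x (insert k D)"
      using assms by (auto simp: subcube_def nth_flip)
  qed
qed

lemma card_subcube:
  "finite D \<Longrightarrow> D \<subseteq> {..<length x} \<Longrightarrow> card (subcube x D) = 2 ^ card D"
proof (induction D arbitrary: x rule: finite_induct)
  case empty
  then show ?case by simp
next
  case (insert k D)
  have "card (subcube x (insert k D)) = card (subcube x D) + card (subcube (flip k x) D)"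
    using subcube_insert[of x x D k] insert by (simp add: card_Un_disjoint)
  then show ?case using insert by simp
qed

section \<open>Plays\<close>

lemma history_in:
  assumes "cop_strategy G \<sigma>" "robber_strategy G \<rho>"
  shows "set (history \<sigma> \<rho> n) \<subseteq> pverts G \<times> pverts G"
proof (induction n)
  case (Suc n)
  then show ?case
    using assms by (auto simp: Let_def cop_strategy_def robber_strategy_def)
qed simp

lemma history_Suc:
  "history \<sigma> \<rho> (Suc n) = history \<sigma> \<rho> n @ [(cop_at \<sigma> \<rho> n, robber_at \<sigma> \<rho> n)]"
  by (simp add: Let_def cop_at_def robber_at_def)

lemma snd_history: "snd ` set (history \<sigma> \<rho> n) = robber_at \<sigma> \<rho> ` {..<n}"
proof (induction n)
  case (Suc n)
  then show ?case by (simp add: history_Suc lessThan_Suc del: history.simps)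
qed simp

lemma positions_in:
  assumes "cop_strategy G \<sigma>" "robber_strategy G \<rho>"
  shows "cop_at \<sigma> \<rho> n \<in> pverts G" "robber_at \<sigma> \<rho> n \<in> pverts G"
  using history_in[OF assms, of "Suc n"] by (simp_all add: history_Suc del: history.simps)

lemma robber_at_legal:
  assumes "cop_strategy G \<sigma>" "robber_strategy G \<rho>"
  shows "legal_move G (robber_at \<sigma> \<rho> n) (robber_at \<sigma> \<rho> (Suc n))"
  using assms(2) history_in[OF assms, of "Suc n"] positions_in(1)[OF assms, of "Suc n"]
  unfolding robber_strategy_def robber_at_def[of _ _ "Suc n"]
  by (fastforce simp: history_Suc simp del: history.simps)

lemma cop_at_legal:
  assumes "cop_strategy G \<sigma>" "robber_strategy G \<rho>"
  shows "legal_move G (cop_at \<sigma> \<rho> n) (cop_at \<sigma> \<rho> (Suc n))"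
  using assms(1) history_in[OF assms, of "Suc n"]
  unfolding cop_strategy_def cop_at_def[of _ _ "Suc n"]
  by (fastforce simp: history_Suc simp del: history.simps)

section \<open>The cop protects three quarters\<close>

definition agreement :: "nat \<Rightarrow> bool list set \<Rightarrow> nat set" where
  "agreement d X = {i. i < d \<and> (\<exists>b. \<forall>x\<in>X. x ! i = b)}"

text \<open>The cop could remember the robber's last direction in order to copy it. Choosing an
  element of the difference on which the visited vertices disagree has the same effect: all
  earlier differences lie in the agreement set, so the robber's last direction is the only
  candidate.\<close>

definition confining_cop :: "nat \<Rightarrow> bool list cop_strategy" where
  "confining_cop d h =
     (if h = [] then replicate d False
      else let c = fst (last h); S = diff c (snd (last h)); A = agreement d (snd ` set h)
        in if even (card S) then c
           else if S \<subseteq> A then flip (SOME i. i \<in> S) c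
           else flip (SOME i. i \<in> S - A) c)"

lemma card_toggle:
  "finite S \<Longrightarrow> even (card (toggle k S)) \<longleftrightarrow> odd (card S)"
  by (cases "k \<in> S") (auto simp: toggle_def card_Diff_singleton card_gt_0_iff)

lemma confining_flips:
  assumes "odd (card (diff c r))"
  obtains i where "i \<in> diff c r" "confining_cop d (h @ [(c, r)]) = flip i c"
    "i \<notin> agreement d (snd ` set (h @ [(c, r)])) \<or>
     diff c r \<subseteq> agreement d (snd ` set (h @ [(c, r)]))"
proof -
  let ?S = "diff c r" and ?A = "agreement d (snd ` set (h @ [(c, r)]))"
  have "?S \<noteq> {}" using assms by auto
  show ?thesis
  proof (cases "?S \<subseteq> ?A")
    case True
    have "(SOME i. i \<in> ?S) \<in> ?S" using \<open>?S \<noteq> {}\<close> by (simp add: some_in_eq)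
    with True assms that[of "SOME i. i \<in> ?S"] show ?thesis
      by (simp add: confining_cop_def Let_def)
  next
    case False
    then have "\<exists>i. i \<in> ?S - ?A" by blast
    then have "(SOME i. i \<in> ?S - ?A) \<in> ?S - ?A" by (rule someI_ex)
    with False assms that[of "SOME i. i \<in> ?S - ?A"] show ?thesis
      by (simp add: confining_cop_def Let_def)
  qed
qed

lemma confining_legal: "cop_strategy (hypercube d) (confining_cop d)"
  unfolding cop_strategy_def
proof (intro allI impI)
  fix h assume h: "set h \<subseteq> pverts (hypercube d) \<times> pverts (hypercube d)"
  show "confining_cop d h \<in> pverts (hypercube d) \<and>
     (h \<noteq> [] \<longrightarrow> legal_move (hypercube d) (fst (last h)) (confining_cop d h))"
  proof (cases h rule: rev_cases)
    case Nil
    then show ?thesis by (simp add: confining_cop_def pverts_hypercube)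
  next
    case (snoc h' p)
    obtain c r where p: "p = (c, r)" by fastforce
    have len: "length c = d" using h snoc p by (auto simp: pverts_hypercube)
    have "confining_cop d h = c \<or> (\<exists>i<d. confining_cop d h = flip i c)"
    proof (cases "even (card (diff c r))")
      case True
      then show ?thesis by (simp add: confining_cop_def snoc p Let_def)
    next
      case False
      then obtain i where "i \<in> diff c r" "confining_cop d h = flip i c"
        using confining_flips snoc p by metis
      then show ?thesis using len by (auto simp: diff_def)
    qed
    then show ?thesis
      using len by (auto simp: snoc p legal_move_hypercube pverts_hypercube)
  qed
qed

text \<open>The hypotheses describe the positions after a robber's move: at most the direction \<open>x\<close> of
  that move is a difference on which the visited vertices disagree, and if there
  is one, the number of differences is odd.\<close>

lemma confining_step:
  assumes "diff c r - agreement d (snd ` set (h @ [(c, r)])) \<subseteq> {x}"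
    and "even (card (diff c r)) \<Longrightarrow> diff c r \<subseteq> agreement d (snd ` set (h @ [(c, r)]))"
  shows "diff (confining_cop d (h @ [(c, r)])) r \<subseteq> agreement d (snd ` set (h @ [(c, r)]))"
    and "even (card (diff (confining_cop d (h @ [(c, r)])) r))"
proof -
  let ?S = "diff c r" and ?A = "agreement d (snd ` set (h @ [(c, r)]))"
    and ?c = "confining_cop d (h @ [(c, r)])"
  have "diff ?c r \<subseteq> ?A \<and> even (card (diff ?c r))"
  proof (cases "even (card ?S)")
    case True
    then show ?thesis using assms(2) by (simp add: confining_cop_def Let_def)
  next
    case False
    then obtain i where i: "i \<in> ?S" "?c = flip i c" "i \<notin> ?A \<or> ?S \<subseteq> ?A"
      using confining_flips by metis
    have "i < length c" using i(1) by (simp add: diff_def)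
    then have S: "diff ?c r = toggle i ?S" by (simp add: i(2) diff_flip_left)
    have "toggle i ?S \<subseteq> ?A" using i assms(1) by (auto simp: toggle_def)
    then show ?thesis using S False by (simp add: card_toggle)
  qed
  then show "diff ?c r \<subseteq> ?A" "even (card (diff ?c r))" by auto
qed

text \<open>If the robber moves along \<open>k\<close>, the agreement set loses at most \<open>k\<close>. If \<open>k\<close> was a
  difference, the difference set loses it as well; otherwise \<open>k\<close> is the only new difference and \<open>confining_step\<close> removes
  it.\<close>

lemma confining_invariant:
  fixes \<rho> :: "bool list robber_strategy" and d :: nat
  defines "c \<equiv> cop_at (confining_cop d) \<rho>" and "r \<equiv> robber_at (confining_cop d) \<rho>"
  assumes \<rho>: "robber_strategy (hypercube d) \<rho>"
  shows "diff (c (Suc n)) (r n) \<subseteq> agreement d (r ` {..n}) \<and>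
    even (card (diff (c (Suc n)) (r n)))"
proof (induction n)
  note strat = confining_legal \<rho>
  have len: "length (c n) = d" "length (r n) = d" for n
    using positions_in[OF strat] by (simp_all add: c_def r_def pverts_hypercube)
  have hist: "history (confining_cop d) \<rho> (Suc n) = history (confining_cop d) \<rho> n @ [(c n, r n)]"
    and c_Suc: "c (Suc n) = confining_cop d (history (confining_cop d) \<rho> n @ [(c n, r n)])"
    and past: "snd ` set (history (confining_cop d) \<rho> n @ [(c n, r n)]) = r ` {..n}" for n
  proof -
    show hist: "history (confining_cop d) \<rho> (Suc n) = history (confining_cop d) \<rho> n @ [(c n, r n)]"
      unfolding c_def r_def by (rule history_Suc)
    show "c (Suc n) = confining_cop d (history (confining_cop d) \<rho> n @ [(c n, r n)])"
      unfolding c_def cop_at_def[of _ _ "Suc n"] using hist c_def by simp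
    show "snd ` set (history (confining_cop d) \<rho> n @ [(c n, r n)]) = r ` {..n}"
      using snd_history[of "confining_cop d" \<rho> "Suc n"]
      unfolding hist r_def by (simp add: lessThan_Suc_atMost)
  qed
  note step = confining_step[of "c n" "r n" d "history (confining_cop d) \<rho> n" for n,
      unfolded past, folded c_Suc]
  {
    case 0
    have "diff (c 0) (r 0) \<subseteq> agreement d (r ` {..0})"
      using len by (auto simp: diff_def agreement_def)
    then show ?case using step[of 0 0] by auto
  next
    case (Suc n)
    let ?S = "diff (c (Suc n)) (r n)" and ?A = "agreement d (r ` {..n})"
    let ?S' = "diff (c (Suc n)) (r (Suc n))" and ?A' = "agreement d (r ` {..Suc n})"
    have ins: "r ` {..Suc n} = insert (r (Suc n)) (r ` {..n})" by (simp add: atMost_Suc)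
    have "r (Suc n) = r n \<or> (\<exists>k<d. r (Suc n) = flip k (r n))"
      using robber_at_legal[OF strat, of n] len(2) legal_move_hypercube unfolding r_def by blast
    then consider "r (Suc n) = r n" | k where "k < d" "r (Suc n) = flip k (r n)" by blast
    then have "\<exists>x. ?S' - ?A' \<subseteq> {x} \<and> (even (card ?S') \<longrightarrow> ?S' \<subseteq> ?A')"
    proof cases
      case 1
      then have "?A' = ?A" unfolding ins by (simp add: insert_absorb)
      then show ?thesis using Suc 1 by auto
    next
      case 2
      have S': "?S' = toggle k ?S" using 2 len by (simp add: diff_flip_right)
      have "?A - {k} \<subseteq> ?A'"
      proof
        fix i assume "i \<in> ?A - {k}"
        then have i: "i < d" "i \<noteq> k" and "\<exists>b. \<forall>x \<in> r ` {..n}. x ! i = b"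
          by (simp_all add: agreement_def)
        then obtain b where b: "\<forall>x \<in> r ` {..n}. x ! i = b" by blast
        then have "r n ! i = b" by simp
        then have "r (Suc n) ! i = b" using 2 i len(2)[of n] by (simp add: nth_flip)
        then have "\<forall>x \<in> insert (r (Suc n)) (r ` {..n}). x ! i = b" using b by simp
        then show "i \<in> ?A'" unfolding ins agreement_def using i(1) by blast
      qed
      then have "?S' - ?A' \<subseteq> {k}" using Suc S' by (auto simp: toggle_def)
      moreover have "odd (card ?S')" using S' Suc by (simp add: card_toggle)
      ultimately show ?thesis by blast
    qed
    then show ?case using step[of "Suc n"] by blast
  }
qed

text \<open>Each bounded part of the play is covered by the invariant. As there are finitely many
  vertices, a single round \<open>N\<close> is late enough for all the damage.\<close>

lemma damaged_confining:
  assumes \<rho>: "robber_strategy (hypercube d) \<rho>"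
  shows "card (damaged (confining_cop d) \<rho>) \<le> 2 ^ (d - 2)"
proof (cases "damaged (confining_cop d) \<rho> = {}")
  case False
  define c where "c = cop_at (confining_cop d) \<rho>"
  define r where "r = robber_at (confining_cop d) \<rho>"
  note strat = confining_legal \<rho>
  have len: "length (c n) = d" "length (r n) = d" for n
    using positions_in[OF strat] by (simp_all add: c_def r_def pverts_hypercube)
  define D where "D = damaged (confining_cop d) \<rho>"
  have D: "D = {r n | n. \<forall>m \<le> Suc n. \<not> caught_in (confining_cop d) \<rho> m}"
    by (simp add: D_def damaged_def r_def)
  have "D \<subseteq> {x. length x = d}" using len D by auto
  then have fin: "finite D"
    using finite_lists_length_eq[of "UNIV :: bool set" d] finite_subset by fastforce
  have "\<exists>f. \<forall>x\<in>D. r (f x) = x \<and> (\<forall>m \<le> Suc (f x). \<not> caught_in (confining_cop d) \<rho> m)"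
    by (rule bchoice) (auto simp: D)
  then obtain f where f: "\<And>x. x \<in> D \<Longrightarrow> r (f x) = x"
    "\<And>x m. x \<in> D \<Longrightarrow> m \<le> Suc (f x) \<Longrightarrow> \<not> caught_in (confining_cop d) \<rho> m" by blast
  define N where "N = Max (f ` D)"
  have "D \<noteq> {}" using False D_def by simp
  then have "N \<in> f ` D" using fin unfolding N_def by simp
  then have free: "\<not> caught_in (confining_cop d) \<rho> (Suc N)" using f(2) by blast
  let ?A = "agreement d (r ` {..N})" and ?S = "diff (c (Suc N)) (r N)"
  have "D \<subseteq> r ` {..N}"
  proof
    fix x assume "x \<in> D"
    then have "f x \<le> N" using fin unfolding N_def by simp
    then show "x \<in> r ` {..N}" using f(1)[OF \<open>x \<in> D\<close>] by force
  qed
  also have "\<dots> \<subseteq> subcube (r N) ({..<d} - ?A)"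
  proof
    fix x assume x: "x \<in> r ` {..N}"
    have "x ! i = r N ! i" if "i \<in> ?A" for i
      using that x unfolding agreement_def by blast
    then show "x \<in> subcube (r N) ({..<d} - ?A)"
      using x len by (auto simp: subcube_def)
  qed
  finally have "card D \<le> card (subcube (r N) ({..<d} - ?A))"
    by (simp add: card_mono)
  also have "\<dots> = 2 ^ (d - card ?A)"
  proof -
    have "?A \<subseteq> {..<d}" by (auto simp: agreement_def)
    then have "card ({..<d} - ?A) = d - card ?A"
      by (simp add: card_Diff_subset finite_subset)
    then show ?thesis using card_subcube[of "{..<d} - ?A" "r N"] len by simp
  qed
  also have "\<dots> \<le> 2 ^ (d - 2)"
  proof -
    have inv: "?S \<subseteq> ?A" "even (card ?S)"
      using confining_invariant[OF \<rho>, of N] by (simp_all add: c_def r_def)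
    have "c (Suc N) \<noteq> r N" using free by (simp add: caught_in_def c_def r_def)
    then have "?S \<noteq> {}" using len by (simp add: diff_empty_iff)
    then have "card ?S \<noteq> 0" by simp
    then have "2 \<le> card ?S" using inv(2) by presburger
    also have "\<dots> \<le> card ?A" using inv(1) by (rule card_mono[rotated]) (simp add: agreement_def)
    finally show ?thesis by simp
  qed
  finally show ?thesis by (simp add: D_def)
qed simp

section \<open>Plans of the robber\<close>

text \<open>A position consists of the robber's vertex, the difference set and the set of vertices that
  have been damaged or are certain to be; it is taken just after a move of the cop that did not
  capture, so the robber's current vertex may be counted.\<close>

type_synonym goal = "bool list \<Rightarrow> nat set \<Rightarrow> bool list set \<Rightarrow> bool"

definition replies :: "nat \<Rightarrow> nat set \<Rightarrow> nat set set" where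
  "replies d S = insert S ((\<lambda>k. toggle k S) ` {..<d})"

lemma replyE:
  assumes "T \<in> replies d S"
  obtains "T = S" | x where "x < d" "T = toggle x S"
  using assms by (auto simp: replies_def)

text \<open>The cop cannot remove two differences at once.\<close>

lemma reply_meets:
  "T \<in> replies d S \<Longrightarrow> a \<in> S \<Longrightarrow> b \<in> S \<Longrightarrow> a \<noteq> b \<Longrightarrow> a \<in> T \<or> b \<in> T"
  by (auto simp: mem_toggle elim!: replyE)

text \<open>The robber always moves, never stays. The cop may answer by staying, so the demand that all
  replies be nonempty includes that the robber does not run into the cop.\<close>

inductive robber_forces :: "nat \<Rightarrow> goal \<Rightarrow> goal" for d :: nat and Q :: goal where
  reached: "Q x S V \<Longrightarrow> robber_forces d Q x S V"
| move: "k < d \<Longrightarrow>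
    (\<forall>T \<in> replies d (toggle k S).
       T \<noteq> {} \<and> robber_forces d Q (flip k x) T (insert (flip k x) V)) \<Longrightarrow>
    robber_forces d Q x S V"

lemma robber_forces_bind:
  assumes "robber_forces d P x S V" "\<And>x S V. P x S V \<Longrightarrow> robber_forces d Q x S V"
  shows "robber_forces d Q x S V"
  using assms(1)
proof induction
  case reached
  then show ?case by (rule assms(2))
next
  case move
  then show ?case by (meson robber_forces.move)
qed

text \<open>As long as the cop's situation satisfies \<open>H\<close>, every direction in \<open>D\<close> is safe, so the robber
  can follow a Hamiltonian path of the subcube, built by doubling; \<open>B\<close> is what interrupts
  him.\<close>

lemma robber_forces_tour:
  assumes "finite D" "D \<subseteq> {..<d}" "length x = d" "x \<in> V" "H S"
    and "\<And>S k T. H S \<Longrightarrow> k \<in> D \<Longrightarrow> T \<in> replies d (toggle k S) \<Longrightarrow> T \<noteq> {} \<and> (H T \<or> B T)"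
  shows "robber_forces d (\<lambda>y T W. y \<in> subcube x D \<and> y \<in> W \<and> V \<subseteq> W \<and>
           (H T \<and> subcube x D \<subseteq> W \<or> B T)) x S V"
  using assms
proof (induction D arbitrary: x S V rule: finite_induct)
  case empty
  then show ?case by (intro reached) simp
next
  case (insert k D)
  let ?goal = "\<lambda>y T W. y \<in> subcube x (insert k D) \<and> y \<in> W \<and> V \<subseteq> W \<and>
           (H T \<and> subcube x (insert k D) \<subseteq> W \<or> B T)"
  have k: "k < length x" using insert.prems by simp
  have hold: "T \<noteq> {} \<and> (H T \<or> B T)"
    if "H S" "l \<in> insert k D" "T \<in> replies d (toggle l S)" for S l T
    using insert.prems(5) that by blast
  have "robber_forces d (\<lambda>y T W. y \<in> subcube x D \<and> y \<in> W \<and> V \<subseteq> W \<and>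
           (H T \<and> subcube x D \<subseteq> W \<or> B T)) x S V"
    using insert.prems hold by (intro insert.IH) auto
  then show ?case
  proof (rule robber_forces_bind, elim conjE disjE)
    fix y T W assume "y \<in> subcube x D" "y \<in> W" "V \<subseteq> W" "B T"
    then show "robber_forces d ?goal y T W"
      using subcube_mono[of D "insert k D" x] by (intro reached) auto
  next
    fix y T W assume y: "y \<in> subcube x D" "y \<in> W" "V \<subseteq> W" "H T" "subcube x D \<subseteq> W"
    note halves = subcube_insert[OF y(1) k insert.hyps(2)]
    let ?z = "flip k y"
    show "robber_forces d ?goal y T W"
    proof (rule move[of k], use insert.prems in simp, intro ballI conjI)
      fix U assume U: "U \<in> replies d (toggle k T)"
      show "U \<noteq> {}" using hold[OF y(4) _ U] by simp
      have "H U \<or> B U" using hold[OF y(4) _ U] by simp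
      then show "robber_forces d ?goal ?z U (insert ?z W)"
      proof
        assume "B U"
        then show ?thesis using y halves by (intro reached) auto
      next
        assume "H U"
        have "robber_forces d (\<lambda>w T' W'. w \<in> subcube ?z D \<and> w \<in> W' \<and> insert ?z W \<subseteq> W' \<and>
           (H T' \<and> subcube ?z D \<subseteq> W' \<or> B T')) ?z U (insert ?z W)"
          using insert.prems hold y(1) \<open>H U\<close> by (intro insert.IH) (auto simp: length_subcube)
        then show ?thesis
          by (rule robber_forces_bind) (use y halves in \<open>intro reached, auto\<close>)
      qed
    qed
  qed
qed

lemma card_visited_halves:
  assumes "y \<in> subcube x D" "k < length x" "k \<notin> D"
    and "a \<le> card (W \<inter> subcube x D)" "b \<le> card (W \<inter> subcube (flip k y) D)"
  shows "a + b \<le> card (W \<inter> subcube x (insert k D))"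
proof -
  note halves = subcube_insert[OF assms(1-3)]
  have "card (W \<inter> subcube x (insert k D)) =
      card (W \<inter> subcube x D) + card (W \<inter> subcube (flip k y) D)"
    unfolding halves(1) Int_Un_distrib using halves(2) by (intro card_Un_disjoint) auto
  then show ?thesis using assms(4,5) by linarith
qed

lemma card_visited_mono: "V \<subseteq> W \<Longrightarrow> card (V \<inter> subcube x D) \<le> card (W \<inter> subcube x D)"
  by (intro card_mono) auto

text \<open>Two halves of the subcube spanned by \<open>insert k F\<close> are joined by the direction \<open>k\<close>. The robber
  cannot cross from one to the other exactly when, within \<open>insert k F\<close>, the cop differs from him
  in \<open>k\<close> alone or in \<open>k\<close> and one further \<open>m\<close>. The first case is excluded by \<open>S \<inter> F \<noteq> {}\<close>.\<close>

definition chased :: "nat \<Rightarrow> nat set \<Rightarrow> nat \<Rightarrow> nat set \<Rightarrow> bool" where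
  "chased k F m S \<longleftrightarrow> S \<inter> insert k F = {k, m}"

definition crossable :: "nat \<Rightarrow> nat set \<Rightarrow> nat set \<Rightarrow> bool" where
  "crossable k F S \<longleftrightarrow> S \<inter> F \<noteq> {} \<and> (\<forall>m\<in>F. \<not> chased k F m S)"

text \<open>The robber's move along \<open>l\<close> makes the difference \<open>{k, m, l}\<close>. The cop obstructs the crossing
  only by removing \<open>l\<close>, which copies him, or \<open>m\<close>, which puts her behind him.\<close>

lemma chased_reply:
  assumes "chased k F m S" "k \<notin> F" "m \<in> F" "l \<in> F" "l \<noteq> m" "T \<in> replies d (toggle l S)"
  shows "T \<noteq> {} \<and> (chased k F m T \<or> chased k F l T \<or> crossable k F T)"
proof -
  let ?D = "insert k F" and ?U = "toggle l S"
  have S: "S \<inter> ?D = {k, m}" using assms(1) by (simp add: chased_def)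
  then have "l \<notin> S" using assms(2,4,5) by auto
  then have U: "?U \<inter> ?D = {k, m, l}" using S assms(4) by (auto simp: toggle_def)
  have crossable: "crossable k F T" if "{m, l} \<subseteq> T"
  proof -
    have "T \<inter> F \<noteq> {}" using that assms(3) by blast
    moreover have "T \<inter> ?D \<noteq> {k, n}" for n
    proof
      assume "T \<inter> ?D = {k, n}"
      then have "{m, l} \<subseteq> {k, n}" using that assms(3,4) by blast
      then show False using assms(2-5) by auto
    qed
    ultimately show ?thesis by (simp add: crossable_def chased_def)
  qed
  have ml: "m \<in> ?U" "l \<in> ?U" using U by blast+
  from assms(6) have "chased k F m T \<or> chased k F l T \<or> crossable k F T"
  proof (cases rule: replyE)
    case 1
    then show ?thesis using crossable ml by blast
  next
    case (2 x)
    have "y \<in> ?U \<longleftrightarrow> y \<in> {k, m, l}" if "y \<in> ?D" for y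
      using U that by blast
    then have "y \<in> T \<longleftrightarrow> (y \<in> {k, m, l}) \<noteq> (y = x)" if "y \<in> ?D" for y
      unfolding 2(2) mem_toggle[of y x ?U] using that by (simp only:)
    then have T: "T \<inter> ?D = {y \<in> ?D. (y \<in> {k, m, l}) \<noteq> (y = x)}" by blast
    consider "x = m" | "x = l" | "x \<noteq> m" "x \<noteq> l" by blast
    then show ?thesis
    proof cases
      case 1
      then have "T \<inter> ?D = {k, l}" unfolding T using assms(2-5) by auto
      then show ?thesis by (simp add: chased_def)
    next
      case 2
      then have "T \<inter> ?D = {k, m}" unfolding T using assms(2-5) by auto
      then show ?thesis by (simp add: chased_def)
    next
      case 3
      then have "{m, l} \<subseteq> T" using ml \<open>T = toggle x ?U\<close> by (simp add: mem_toggle)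
      then show ?thesis using crossable by blast
    qed
  qed
  then show ?thesis by (auto simp: chased_def crossable_def)
qed

text \<open>As long as crossing along \<open>k\<close> remains obstructed, the robber can collect half of the subcube
  spanned by \<open>G\<close>, by induction on \<open>G\<close>. Choose \<open>l \<noteq> m\<close>, visit half of the subcube spanned by
  \<open>G' = G - {l}\<close>, then move along \<open>l\<close>. If the cop copies this move, the chase continues in the
  other half. If she follows, only going back along \<open>l\<close> is blocked: all directions in \<open>G'\<close> are
  safe and the robber tours this half until she blocks some direction in \<open>G'\<close>; from there on the
  chase continues in it. The goal ends the chase with a blocked direction in \<open>G\<close>; for \<open>G'\<close> this
  makes the move along \<open>l\<close> safe.\<close>

lemma robber_forces_chase:
  assumes "F \<subseteq> {..<d}" "k \<notin> F" "finite G" "G \<subseteq> F" "m \<in> G" "chased k F m S"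
    "length x = d" "x \<in> V"
  shows "robber_forces d (\<lambda>y T W. y \<in> subcube x G \<and> y \<in> W \<and> V \<subseteq> W \<and>
      ((\<exists>m\<in>G. chased k F m T) \<and> 2 ^ (card G - 1) \<le> card (W \<inter> subcube x G) \<or>
       crossable k F T)) x S V"
  using assms(3-)
proof (induction "card G" arbitrary: G m x S V rule: less_induct)
  case less
  let ?goal = "\<lambda>G x V y T W. y \<in> subcube x G \<and> y \<in> W \<and> V \<subseteq> W \<and>
      ((\<exists>m\<in>G. chased k F m T) \<and> 2 ^ (card G - 1) \<le> card (W \<inter> subcube x G) \<or>
       crossable k F T)"
  show ?case
  proof (cases "G = {m}")
    case True
    have "{x} \<subseteq> V \<inter> subcube x G" using less.prems by simp
    then have "1 \<le> card (V \<inter> subcube x G)"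
      by (metis card_mono card.empty card_insert_disjoint empty_iff finite.emptyI finite_Int
          finite_subcube One_nat_def)
    then show ?thesis using less.prems True by (intro reached) auto
  next
    case False
    then obtain l where l: "l \<in> G" "l \<noteq> m" using less.prems by blast
    define G' where "G' = G - {l}"
    have G: "G = insert l G'" "l \<notin> G'" "finite G'" "G' \<subseteq> F" "m \<in> G'"
      using l less.prems by (auto simp: G'_def)
    have cG: "card G = Suc (card G')" using G by simp
    have "0 < card G'" using G by (auto simp: card_gt_0_iff)
    then have pow: "(2::nat) ^ (card G - 1) = 2 ^ (card G' - 1) + 2 ^ (card G' - 1)"
      using cG by (cases "card G'") auto
    have lx: "l < length x" "l < d" using l less.prems assms(1) by auto
    have IH: "robber_forces d (?goal G' z W) z T W"
      if "n \<in> G'" "chased k F n T" "length z = d" "z \<in> W" for n z T W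
      using less.hyps[of G' n T z W] that G cG by simp
    have "robber_forces d (?goal G' x V) x S V"
      using IH[OF G(5)] less.prems by blast
    then show ?thesis
    proof (rule robber_forces_bind, elim conjE disjE bexE)
      fix y T W assume "y \<in> subcube x G'" "y \<in> W" "V \<subseteq> W" "crossable k F T"
      then show "robber_forces d (?goal G x V) y T W"
        using subcube_mono[of G' G x] G(1) by (intro reached) auto
    next
      fix y T W n
      assume y: "y \<in> subcube x G'" "y \<in> W" "V \<subseteq> W"
        and n: "n \<in> G'" "chased k F n T" and cW: "2 ^ (card G' - 1) \<le> card (W \<inter> subcube x G')"
      let ?z = "flip l y"
      have lz: "length ?z = d" using y(1) less.prems by (simp add: length_subcube)
      note halves = subcube_insert[OF y(1) lx(1) G(2), folded G(1)]
      \<comment> \<open>Both continuations below end with a chase in the second half.\<close>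
      have finish: "robber_forces d (?goal G x V) w U X"
        if w: "?goal G' v Y w U X" and v: "v \<in> subcube ?z G'" and Y: "W \<subseteq> Y" for v Y w U X
      proof (rule reached)
        have v': "subcube v G' = subcube ?z G'" using subcube_eq[OF v] .
        have "2 ^ (card G - 1) \<le> card (X \<inter> subcube x G)"
          if that: "2 ^ (card G' - 1) \<le> card (X \<inter> subcube v G')"
        proof -
          have "W \<subseteq> X" using w Y by blast
          then have "2 ^ (card G' - 1) \<le> card (X \<inter> subcube x G')"
            using cW card_visited_mono le_trans by blast
          then show ?thesis
            using card_visited_halves[OF y(1) lx(1) G(2)] that
            by (simp only: pow v' G(1)[symmetric])
        qed
        then show "?goal G x V w U X"
          using w v' Y y(3) halves(1) G(1) by blast
      qed
      show "robber_forces d (?goal G x V) y T W"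
      proof (rule move[OF lx(2)], intro ballI conjI)
        fix U assume U: "U \<in> replies d (toggle l T)"
        have reply: "U \<noteq> {} \<and> (chased k F n U \<or> chased k F l U \<or> crossable k F U)"
          by (rule chased_reply[OF n(2) assms(2) _ _ _ U]) (use G n l less.prems in auto)
        then show "U \<noteq> {}" ..
        consider "crossable k F U" | "chased k F n U" | "chased k F l U" using reply by blast
        then show "robber_forces d (?goal G x V) ?z U (insert ?z W)"
        proof cases
          case 1
          then show ?thesis using y halves(1) by (intro reached) auto
        next
          case 2
          have "robber_forces d (?goal G' ?z (insert ?z W)) ?z U (insert ?z W)"
            using IH[OF n(1) 2 lz] by blast
          then show ?thesis by (rule robber_forces_bind) (rule finish, auto)
        next
          case 3
          let ?B = "\<lambda>T. (\<exists>n\<in>G'. chased k F n T) \<or> crossable k F T"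
          have "robber_forces d (\<lambda>v T X. v \<in> subcube ?z G' \<and> v \<in> X \<and> insert ?z W \<subseteq> X \<and>
              (chased k F l T \<and> subcube ?z G' \<subseteq> X \<or> ?B T)) ?z U (insert ?z W)"
          proof (rule robber_forces_tour)
            show "T \<noteq> {} \<and> (chased k F l T \<or> ?B T)"
              if "chased k F l S" "n \<in> G'" "T \<in> replies d (toggle n S)" for S n T
              using chased_reply[OF that(1) assms(2) _ _ _ that(3)] that(2) G l less.prems by blast
          qed (use G lz 3 assms(1) in auto)
          then show ?thesis
          proof (rule robber_forces_bind, elim conjE disjE bexE)
            fix v T X assume v: "v \<in> subcube ?z G'" "v \<in> X" "insert ?z W \<subseteq> X"
              and all: "chased k F l T" "subcube ?z G' \<subseteq> X"
            have "2 ^ (card G - 1) = card (subcube ?z G')"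
              using card_subcube[of G' ?z] G lz cG assms(1) by auto
            also have "\<dots> \<le> card (X \<inter> subcube x G)"
              using all halves(1) by (intro card_mono) auto
            finally show "robber_forces d (?goal G x V) v T X"
              using v all y l halves(1) by (intro reached) auto
          next
            fix v T X assume "v \<in> subcube ?z G'" "v \<in> X" "insert ?z W \<subseteq> X" "crossable k F T"
            then show "robber_forces d (?goal G x V) v T X"
              using y halves(1) by (intro reached) auto
          next
            fix v T X n' assume v: "v \<in> subcube ?z G'" "v \<in> X" "insert ?z W \<subseteq> X"
              and n': "n' \<in> G'" "chased k F n' T"
            have "robber_forces d (?goal G' v X) v T X"
              using IH[OF n'] v lz by (simp add: length_subcube)
            then show "robber_forces d (?goal G x V) v T X"
              by (rule robber_forces_bind) (rule finish, use v in auto)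
          qed
        qed
      qed
    qed
  qed
qed

text \<open>After a permitted crossing at least two differences remain, so that the cop cannot capture
  the robber; at worst her projection to \<open>F\<close> catches up with his, which leaves \<open>{k}\<close>.\<close>

lemma crossing_reply:
  assumes "crossable k F S" "k \<notin> F" "T \<in> replies d (toggle k S)"
  shows "T \<inter> F \<noteq> {} \<or> T \<inter> insert k F = {k}"
proof (rule ccontr)
  assume not: "\<not> ?thesis"
  then have T: "T \<inter> insert k F = {}" by auto
  obtain m where m: "m \<in> S" "m \<in> F" using assms(1) by (auto simp: crossable_def)
  have "m \<in> toggle k S" "m \<notin> T" using m T assms(2) by (auto simp: toggle_def)
  then have T': "T = toggle m (toggle k S)"
    using assms(3) by (auto simp: mem_toggle elim!: replyE)
  have "y \<in> S \<longleftrightarrow> y \<in> {k, m}" if "y \<in> insert k F" for y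
    using T that m(2) assms(2) unfolding T' by (auto simp: mem_toggle set_eq_iff)
  then have "S \<inter> insert k F = {k, m}" using m(2) by blast
  then show False using assms(1) m by (auto simp: crossable_def chased_def)
qed

text \<open>The positive projected distance \<open>T \<inter> D \<noteq> {}\<close> in the goal makes the plan repeatable in the
  second half. The cop may also move outside of \<open>D\<close>; this looks like staying.\<close>

lemma robber_forces_quarter:
  assumes "finite D" "D \<subseteq> {..<d}" "2 \<le> card D" "S \<inter> D \<noteq> {}" "length x = d" "x \<in> V"
  shows "robber_forces d (\<lambda>y T W. y \<in> subcube x D \<and> y \<in> W \<and> V \<subseteq> W \<and> T \<inter> D \<noteq> {} \<and>
      2 ^ (card D - 2) \<le> card (W \<inter> subcube x D)) x S V"
  using assms
proof (induction "card D" arbitrary: D x S V rule: less_induct)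
  case less
  let ?goal = "\<lambda>D x V y T W. y \<in> subcube x D \<and> y \<in> W \<and> V \<subseteq> W \<and> T \<inter> D \<noteq> {} \<and>
      2 ^ (card D - 2) \<le> card (W \<inter> subcube x D)"
  show ?case
  proof (cases "card D = 2")
    case True
    have "V \<inter> subcube x D \<noteq> {}" using less.prems by auto
    then have "1 \<le> card (V \<inter> subcube x D)" by (simp add: Suc_le_eq card_gt_0_iff)
    then show ?thesis using less.prems True by (intro reached) auto
  next
    case False
    obtain m where m: "m \<in> S" "m \<in> D" using less.prems by blast
    have "D \<noteq> {m}" using less.prems(3) by auto
    then obtain k where k: "k \<in> D" "k \<noteq> m" using m by blast
    define F where "F = D - {k}"
    have F: "D = insert k F" "k \<notin> F" "finite F" "F \<subseteq> {..<d}" "S \<inter> F \<noteq> {}"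
      using k m less.prems by (auto simp: F_def)
    have cF: "card D = Suc (card F)" using F by simp
    then have "2 \<le> card F" using less.prems False by simp
    then obtain j where "card F = j + 2" by (metis add.commute le_Suc_ex)
    then have pow: "(2::nat) ^ (card D - 2) = 2 ^ (card F - 2) + 2 ^ (card F - 2)"
      "(2::nat) ^ (card D - 2) = 2 ^ (card F - 1)"
      using cF by simp_all
    have kx: "k < length x" "k < d" using k less.prems by auto
    have IH: "robber_forces d (?goal F z W) z T W"
      if "T \<inter> F \<noteq> {}" "length z = d" "z \<in> W" for z T W
      using less.hyps[of F T z W] that F cF \<open>2 \<le> card F\<close> by simp
    have sub: "subcube x F \<subseteq> subcube x D" using F(1) by (intro subcube_mono) auto
    \<comment> \<open>From any position where the first half has its share and crossing is safe, the second
      half can be given its share.\<close>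
    have cross: "robber_forces d (?goal D x V) y T W"
      if y: "y \<in> subcube x F" "y \<in> W" "V \<subseteq> W" "crossable k F T"
        "2 ^ (card F - 2) \<le> card (W \<inter> subcube x F)" for y T W
    proof (rule move[OF kx(2)], intro ballI conjI)
      let ?z = "flip k y"
      have lz: "length ?z = d" using y(1) less.prems by (simp add: length_subcube)
      note halves = subcube_insert[OF y(1) kx(1) F(2), folded F(1)]
      \<comment> \<open>The cop may delay this by keeping the projected distance 0 after the crossing, hence
        the arbitrary later position \<open>v\<close> in the second half.\<close>
      have second: "robber_forces d (?goal D x V) v U X"
        if v: "v \<in> subcube ?z F" "v \<in> X" "W \<subseteq> X" "U \<inter> F \<noteq> {}" for v U X
      proof -
        have v': "subcube v F = subcube ?z F" using subcube_eq[OF v(1)] .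
        have "robber_forces d (?goal F v X) v U X"
          using IH v lz by (simp add: length_subcube)
        then show ?thesis
        proof (rule robber_forces_bind)
          fix w U' X' assume w: "?goal F v X w U' X'"
          have "W \<subseteq> X'" using w v(3) by blast
          then have "2 ^ (card F - 2) \<le> card (X' \<inter> subcube x F)"
            using y(5) card_visited_mono le_trans by blast
          moreover have "2 ^ (card F - 2) \<le> card (X' \<inter> subcube ?z F)" using w v' by simp
          ultimately have "2 ^ (card D - 2) \<le> card (X' \<inter> subcube x D)"
            using card_visited_halves[OF y(1) kx(1) F(2)]
            by (simp only: pow(1) F(1)[symmetric])
          then show "robber_forces d (?goal D x V) w U' X'"
            using w v v' y halves(1) F(1) by (intro reached) blast
        qed
      qed
      fix U assume U: "U \<in> replies d (toggle k T)"
      have reply: "U \<inter> F \<noteq> {} \<or> U \<inter> D = {k}"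
        using crossing_reply[OF y(4) F(2) U] F(1) by simp
      then show "U \<noteq> {}" by auto
      from reply show "robber_forces d (?goal D x V) ?z U (insert ?z W)"
      proof
        assume "U \<inter> F \<noteq> {}"
        then show ?thesis by (intro second) auto
      next
        assume "U \<inter> D = {k}"
        have "robber_forces d (\<lambda>v T X. v \<in> subcube ?z F \<and> v \<in> X \<and> insert ?z W \<subseteq> X \<and>
            (T \<inter> D = {k} \<and> subcube ?z F \<subseteq> X \<or> T \<inter> F \<noteq> {})) ?z U (insert ?z W)"
        proof (rule robber_forces_tour)
          fix S l T assume S: "S \<inter> D = {k}" "l \<in> F" "T \<in> replies d (toggle l S)"
          have "{k, l} \<subseteq> toggle l S" "k \<noteq> l" "{k, l} \<subseteq> D"
            using S F(1,2) by (auto simp: mem_toggle)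
          then have "T \<inter> D \<noteq> {}" using reply_meets[OF S(3), of k l] by blast
          then show "T \<noteq> {} \<and> (T \<inter> D = {k} \<or> T \<inter> F \<noteq> {})" using F(1) by auto
        qed (use F lz \<open>U \<inter> D = {k}\<close> in auto)
        then show ?thesis
        proof (rule robber_forces_bind, elim conjE disjE)
          fix v T X assume v: "v \<in> subcube ?z F" "v \<in> X" "insert ?z W \<subseteq> X"
            and all: "T \<inter> D = {k}" "subcube ?z F \<subseteq> X"
          have "2 ^ (card D - 2) \<le> (2::nat) ^ card F" using cF by simp
          also have "\<dots> = card (subcube ?z F)"
            using card_subcube[of F ?z] F lz by simp
          also have "\<dots> \<le> card (X \<inter> subcube x D)"
            using all halves(1) by (intro card_mono) auto
          finally show "robber_forces d (?goal D x V) v T X"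
            using v all y halves(1) by (intro reached) auto
        qed (rule second, auto)
      qed
    qed
    have "robber_forces d (?goal F x V) x S V" using IH F(5) less.prems by blast
    then show ?thesis
    proof (rule robber_forces_bind, elim conjE)
      fix y T W
      assume y: "y \<in> subcube x F" "y \<in> W" "V \<subseteq> W" "T \<inter> F \<noteq> {}"
        "2 ^ (card F - 2) \<le> card (W \<inter> subcube x F)"
      show "robber_forces d (?goal D x V) y T W"
      proof (cases "crossable k F T")
        case True
        then show ?thesis using cross y by blast
      next
        case False
        then obtain m where m: "m \<in> F" "chased k F m T"
          using y(4) by (auto simp: crossable_def)
        have len: "length y = d" using y(1) less.prems by (simp add: length_subcube)
        have eq: "subcube y F = subcube x F" using subcube_eq[OF y(1)] .
        have "robber_forces d (\<lambda>v U X. v \<in> subcube y F \<and> v \<in> X \<and> W \<subseteq> X \<and>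
            ((\<exists>m\<in>F. chased k F m U) \<and> 2 ^ (card F - 1) \<le> card (X \<inter> subcube y F) \<or>
             crossable k F U)) y T W"
          using F m len y by (intro robber_forces_chase) auto
        then show ?thesis
        proof (rule robber_forces_bind, unfold eq, elim conjE disjE bexE)
          fix v U X m assume v: "v \<in> subcube x F" "v \<in> X" "W \<subseteq> X"
            and m: "chased k F m U" "2 ^ (card F - 1) \<le> card (X \<inter> subcube x F)"
          have "U \<inter> D \<noteq> {}" using m F(1) by (auto simp: chased_def)
          moreover have "card (X \<inter> subcube x F) \<le> card (X \<inter> subcube x D)"
            using sub by (intro card_mono) auto
          ultimately show "robber_forces d (?goal D x V) v U X"
            using v m sub y pow(2) by (intro reached) auto
        next
          fix v U X assume v: "v \<in> subcube x F" "v \<in> X" "W \<subseteq> X" "crossable k F U"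
          have "2 ^ (card F - 2) \<le> card (X \<inter> subcube x F)"
            using y(5) card_visited_mono[OF v(3)] le_trans by blast
          then show "robber_forces d (?goal D x V) v U X" using cross v y by blast
        qed
      qed
    qed
  qed
qed

section \<open>From plans to strategies\<close>

text \<open>A bound on the number of rounds gives the measure by which a strategy makes progress.\<close>

primrec forces_within :: "nat \<Rightarrow> goal \<Rightarrow> nat \<Rightarrow> goal" where
  "forces_within d Q 0 x S V \<longleftrightarrow> Q x S V"
| "forces_within d Q (Suc n) x S V \<longleftrightarrow> Q x S V \<or>
     (\<exists>k<d. \<forall>T \<in> replies d (toggle k S).
        T \<noteq> {} \<and> forces_within d Q n (flip k x) T (insert (flip k x) V))"

lemma forces_within_Suc: "forces_within d Q n x S V \<Longrightarrow> forces_within d Q (Suc n) x S V"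
proof (induction n arbitrary: x S V)
  case (Suc n)
  from Suc.prems have "Q x S V \<or> (\<exists>k<d. \<forall>T \<in> replies d (toggle k S).
        T \<noteq> {} \<and> forces_within d Q n (flip k x) T (insert (flip k x) V))" by simp
  then have "Q x S V \<or> (\<exists>k<d. \<forall>T \<in> replies d (toggle k S).
        T \<noteq> {} \<and> forces_within d Q (Suc n) (flip k x) T (insert (flip k x) V))"
    using Suc.IH by blast
  then show ?case by (simp only: forces_within.simps(2)[of d Q "Suc n"])
qed simp

lemma forces_within_mono:
  assumes "forces_within d Q m x S V" "m \<le> n"
  shows "forces_within d Q n x S V"
  using assms(2)
proof (induction n rule: dec_induct)
  case base
  show ?case by (rule assms(1))
next
  case (step n)
  show ?case by (rule forces_within_Suc) (rule step.IH)
qed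

lemma robber_forces_within: "robber_forces d Q x S V \<Longrightarrow> \<exists>n. forces_within d Q n x S V"
proof (induction rule: robber_forces.induct)
  case (reached x S V)
  then show ?case by (intro exI[of _ 0]) simp
next
  case (move k S x V)
  let ?f = "\<lambda>n T. forces_within d Q n (flip k x) T (insert (flip k x) V)"
  have "\<forall>T \<in> replies d (toggle k S). \<exists>n. ?f n T" using move by blast
  then obtain f where f: "\<And>T. T \<in> replies d (toggle k S) \<Longrightarrow> ?f (f T) T" by metis
  define N where "N = Max (f ` replies d (toggle k S))"
  have "finite (replies d (toggle k S))" by (simp add: replies_def)
  then have "?f N T" if "T \<in> replies d (toggle k S)" for T
    using f[OF that] that by (rule_tac forces_within_mono) (auto simp: N_def)
  then have "forces_within d Q (Suc N) x S V" using move by auto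
  then show ?case ..
qed

text \<open>Always playing for the least possible number of remaining rounds makes the choice depend on
  the position only.\<close>

definition forcing_move :: "nat \<Rightarrow> goal \<Rightarrow> bool list \<Rightarrow> nat set \<Rightarrow> bool list set \<Rightarrow> nat" where
  "forcing_move d Q x S V = (SOME k. k < d \<and>
     (\<forall>T \<in> replies d (toggle k S). T \<noteq> {} \<and>
        forces_within d Q ((LEAST n. forces_within d Q n x S V) - 1)
          (flip k x) T (insert (flip k x) V)))"

lemma forcing_move_works:
  assumes "forces_within d Q n x S V" "\<not> Q x S V"
  obtains m where "m < n" "forcing_move d Q x S V < d"
    "\<And>T. T \<in> replies d (toggle (forcing_move d Q x S V) S) \<Longrightarrow> T \<noteq> {} \<and>
        forces_within d Q m (flip (forcing_move d Q x S V) x) T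
          (insert (flip (forcing_move d Q x S V) x) V)"
proof -
  define l where "l = (LEAST n. forces_within d Q n x S V)"
  have l: "forces_within d Q l x S V" "l \<le> n"
    using assms(1) unfolding l_def by (auto intro: LeastI Least_le)
  then obtain m where m: "l = Suc m" using assms(2) by (cases l) auto
  have "\<exists>k. k < d \<and> (\<forall>T \<in> replies d (toggle k S). T \<noteq> {} \<and>
        forces_within d Q (l - 1) (flip k x) T (insert (flip k x) V))"
    using l(1) assms(2) m by auto
  from someI_ex[OF this] show ?thesis
    using that[of m] l(2) m unfolding forcing_move_def l_def[symmetric] by auto
qed

text \<open>The robber starts opposite to the cop. Once the goal is reached he stays, which is safe and
  makes his last vertex count as damaged: a robber who ran into the cop would lose it.
  In positions from which the goal is not forced, \<open>forcing_move\<close> is arbitrary and the test \<open>k < d\<close>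
  keeps the answer legal.\<close>

definition forcing_strategy :: "nat \<Rightarrow> goal \<Rightarrow> bool list robber_strategy" where
  "forcing_strategy d Q h c =
     (if h = [] then map Not c
      else let x = snd (last h); S = diff c x; V = snd ` set h; k = forcing_move d Q x S V
        in if k < d \<and> \<not> Q x S V then flip k x else x)"

lemma forcing_strategy_legal: "robber_strategy (hypercube d) (forcing_strategy d Q)"
  unfolding robber_strategy_def
proof (intro allI impI)
  fix h c assume h: "set h \<subseteq> pverts (hypercube d) \<times> pverts (hypercube d)"
    and c: "c \<in> pverts (hypercube d)"
  show "forcing_strategy d Q h c \<in> pverts (hypercube d) \<and>
     (h \<noteq> [] \<longrightarrow> legal_move (hypercube d) (snd (last h)) (forcing_strategy d Q h c))"
  proof (cases "h = []")
    case True
    then show ?thesis using c by (simp add: forcing_strategy_def pverts_hypercube)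
  next
    case False
    then have "last h \<in> pverts (hypercube d) \<times> pverts (hypercube d)"
      using h last_in_set by blast
    then have len: "length (snd (last h)) = d" by (auto simp: pverts_hypercube)
    then show ?thesis
      using False by (auto simp: forcing_strategy_def Let_def legal_move_hypercube pverts_hypercube)
  qed
qed

text \<open>The hypotheses say that the robber is free just after the cop's move in round \<open>Suc t\<close>, the
  conclusion also covers his own move in that round.\<close>

lemma forcing_strategy_reaches:
  fixes \<sigma> :: "bool list cop_strategy" and d :: nat and Q :: goal
  defines "c \<equiv> cop_at \<sigma> (forcing_strategy d Q)" and "r \<equiv> robber_at \<sigma> (forcing_strategy d Q)"
  assumes \<sigma>: "cop_strategy (hypercube d) \<sigma>"
    and "\<forall>m \<le> t. \<not> caught_in \<sigma> (forcing_strategy d Q) m" "c (Suc t) \<noteq> r t"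
    and "forces_within d Q n (r t) (diff (c (Suc t)) (r t)) (r ` {..t})"
  shows "\<exists>t. (\<forall>m \<le> Suc t. \<not> caught_in \<sigma> (forcing_strategy d Q) m) \<and>
    Q (r t) (diff (c (Suc t)) (r t)) (r ` {..t})"
  using assms(4-)
proof (induction n arbitrary: t rule: less_induct)
  case (less n)
  let ?\<rho> = "forcing_strategy d Q" and ?S = "diff (c (Suc t)) (r t)"
  note strat = \<sigma> forcing_strategy_legal[of d Q]
  have len: "length (c n) = d" "length (r n) = d" for n
    using positions_in[OF strat] by (simp_all add: c_def r_def pverts_hypercube)
  define k where "k = forcing_move d Q (r t) ?S (r ` {..t})"
  have r_Suc: "r (Suc t) = (if k < d \<and> \<not> Q (r t) ?S (r ` {..t}) then flip k (r t) else r t)"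
  proof -
    have "snd ` set (history \<sigma> ?\<rho> (Suc t)) = r ` {..t}"
      unfolding snd_history r_def lessThan_Suc_atMost ..
    moreover have "last (history \<sigma> ?\<rho> (Suc t)) = (c t, r t)"
      and "history \<sigma> ?\<rho> (Suc t) \<noteq> []"
      unfolding history_Suc c_def r_def by simp_all
    moreover have "r (Suc t) = ?\<rho> (history \<sigma> ?\<rho> (Suc t)) (c (Suc t))"
      unfolding r_def c_def robber_at_def ..
    ultimately show ?thesis
      by (simp add: forcing_strategy_def Let_def k_def del: history.simps)
  qed
  have uncaught: "\<forall>m \<le> Suc t. \<not> caught_in \<sigma> ?\<rho> m" if "c (Suc t) \<noteq> r (Suc t)"
    using less.prems that by (auto simp: le_Suc_eq) (auto simp: caught_in_def c_def r_def)
  show ?case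
  proof (cases "Q (r t) ?S (r ` {..t})")
    case True
    then have "c (Suc t) \<noteq> r (Suc t)" using less.prems(2) by (simp add: r_Suc)
    then show ?thesis using uncaught True by blast
  next
    case False
    obtain m where m: "m < n" "k < d"
      "\<And>T. T \<in> replies d (toggle k ?S) \<Longrightarrow> T \<noteq> {} \<and>
        forces_within d Q m (flip k (r t)) T (insert (flip k (r t)) (r ` {..t}))"
      using forcing_move_works[OF less.prems(3) False] unfolding k_def by metis
    have r': "r (Suc t) = flip k (r t)" using r_Suc m(2) False by simp
    let ?T = "diff (c (Suc (Suc t))) (r (Suc t))"
    have S': "diff (c (Suc t)) (r (Suc t)) = toggle k ?S"
      using len m(2) by (simp add: r' diff_flip_right)
    have "c (Suc (Suc t)) = c (Suc t) \<or> (\<exists>l<d. c (Suc (Suc t)) = flip l (c (Suc t)))"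
      using cop_at_legal[OF strat, of "Suc t"] len(1) legal_move_hypercube unfolding c_def by blast
    then have T: "?T \<in> replies d (toggle k ?S)"
      using S' len by (auto simp: replies_def diff_flip_left)
    have forced: "forces_within d Q m (r (Suc t)) ?T (r ` {..Suc t})"
      using m(3)[OF T] by (simp add: r' atMost_Suc)
    have "toggle k ?S \<in> replies d (toggle k ?S)" by (simp add: replies_def)
    then have "toggle k ?S \<noteq> {}" using m(3) by blast
    then have "c (Suc t) \<noteq> r (Suc t)" using S' len by (metis diff_empty_iff)
    moreover have "c (Suc (Suc t)) \<noteq> r (Suc t)"
      using m(3)[OF T] len by (metis diff_empty_iff)
    ultimately show ?thesis using less.IH[OF m(1) _ _ forced] uncaught by blast
  qed
qed

lemma robber_damages_quarter:
  assumes "2 \<le> d"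
  shows "\<exists>\<rho>. robber_strategy (hypercube d) \<rho> \<and>
    (\<forall>\<sigma>. cop_strategy (hypercube d) \<sigma> \<longrightarrow> 2 ^ (d - 2) \<le> card (damaged \<sigma> \<rho>))"
proof (intro exI conjI allI impI)
  let ?E = "{..<d}"
  let ?Q = "\<lambda>y T W. 2 ^ (d - 2) \<le> card (W \<inter> {x. length x = d})"
  let ?\<rho> = "forcing_strategy d ?Q"
  show "robber_strategy (hypercube d) ?\<rho>" by (rule forcing_strategy_legal)
  fix \<sigma> assume \<sigma>: "cop_strategy (hypercube d) \<sigma>"
  define c where "c = cop_at \<sigma> ?\<rho>"
  define r where "r = robber_at \<sigma> ?\<rho>"
  note strat = \<sigma> forcing_strategy_legal[of d ?Q]
  have len: "length (c n) = d" "length (r n) = d" for n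
    using positions_in[OF strat] by (simp_all add: c_def r_def pverts_hypercube)
  have r0: "r 0 = map Not (c 0)"
    by (simp add: r_def c_def robber_at_def forcing_strategy_def)
  have start: "diff (c 0) (r 0) = ?E" using len by (auto simp: diff_def r0)
  let ?S = "diff (c (Suc 0)) (r 0)"
  have "c (Suc 0) = c 0 \<or> (\<exists>l<d. c (Suc 0) = flip l (c 0))"
    using cop_at_legal[OF strat, of 0] len(1) legal_move_hypercube unfolding c_def by blast
  then have reply: "?S \<in> replies d ?E"
    using start len by (auto simp: replies_def diff_flip_left)
  have S: "?S \<inter> ?E \<noteq> {}" using reply_meets[OF reply, of 0 1] assms by auto
  have "robber_forces d ?Q (r 0) ?S {r 0}"
  proof (rule robber_forces_bind)
    show "robber_forces d (\<lambda>y T W. y \<in> subcube (r 0) ?E \<and> y \<in> W \<and> {r 0} \<subseteq> W \<and>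
      T \<inter> ?E \<noteq> {} \<and> 2 ^ (card ?E - 2) \<le> card (W \<inter> subcube (r 0) ?E)) (r 0) ?S {r 0}"
      using assms len S by (intro robber_forces_quarter) auto
  next
    fix y T W
    assume "y \<in> subcube (r 0) ?E \<and> y \<in> W \<and> {r 0} \<subseteq> W \<and>
      T \<inter> ?E \<noteq> {} \<and> 2 ^ (card ?E - 2) \<le> card (W \<inter> subcube (r 0) ?E)"
    moreover have "subcube (r 0) ?E = {x. length x = d}" using len by (auto simp: subcube_def)
    ultimately show "robber_forces d ?Q y T W" by (intro reached) simp
  qed
  then obtain n where "forces_within d ?Q n (r 0) ?S {r 0}"
    using robber_forces_within by blast
  then have forced: "forces_within d ?Q n (r 0) ?S (r ` {..0})" by simp
  have "diff (c 0) (r 0) \<noteq> {}" using start assms by (simp add: lessThan_empty_iff)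
  then have "c 0 \<noteq> r 0" using len by (simp add: diff_empty_iff)
  have "?S \<noteq> {}" using S by blast
  then have "c (Suc 0) \<noteq> r 0" using len by (simp add: diff_empty_iff)
  have "\<forall>m \<le> 0. \<not> caught_in \<sigma> ?\<rho> m"
    using \<open>c 0 \<noteq> r 0\<close> by (simp add: caught_in_def c_def r_def)
  then obtain t where t: "\<forall>m \<le> Suc t. \<not> caught_in \<sigma> ?\<rho> m"
      "2 ^ (d - 2) \<le> card (r ` {..t} \<inter> {x. length x = d})"
    using forcing_strategy_reaches[where Q = ?Q and n = n and t = 0, OF \<sigma>,
        folded c_def r_def, OF _ _ forced]
      \<open>c (Suc 0) \<noteq> r 0\<close> by blast
  have "r ` {..t} \<subseteq> damaged \<sigma> ?\<rho>"
    using t(1) by (fastforce simp: damaged_def r_def)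
  moreover have "damaged \<sigma> ?\<rho> \<subseteq> {x. length x = d}"
    using len by (auto simp: damaged_def r_def)
  moreover have "finite {x :: bool list. length x = d}"
    using finite_lists_length_eq[of "UNIV :: bool set" d] by simp
  ultimately have "card (r ` {..t} \<inter> {x. length x = d}) \<le> card (damaged \<sigma> ?\<rho>)"
    by (intro card_mono) (auto intro: finite_subset)
  then show "2 ^ (d - 2) \<le> card (damaged \<sigma> ?\<rho>)" using t(2) by linarith
qed

theorem theorem1p2:
  fixes d :: nat
  assumes "d \<ge> 2"
  shows "dmg (hypercube d) = 2 ^ (d - 2)"
proof -
  let ?K = "{k. \<exists>\<rho>. robber_strategy (hypercube d) \<rho> \<and>
              (\<forall>\<sigma>. cop_strategy (hypercube d) \<sigma> \<longrightarrow> k \<le> card (damaged \<sigma> \<rho>))}"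
  have upper: "k \<le> 2 ^ (d - 2)" if "k \<in> ?K" for k
    using that confining_legal damaged_confining le_trans by blast
  moreover have "2 ^ (d - 2) \<in> ?K" using robber_damages_quarter[OF assms] by blast
  moreover have "finite ?K" by (rule finite_subset[of _ "{..2 ^ (d - 2)}"]) (use upper in auto)
  ultimately show ?thesis unfolding dmg_def by (intro Max_eqI) auto
qed

end
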